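(* Let $G$ be a Polish group, let $X$ be a Polish space, and let $m$ be a continuous topological partial action of $G$ on $X$ such that $G*X$ is a $G_\delta$ subset of $G\times X$. Let $X_G$ be the enveloping space of $m$ and let $\mu$ be the enveloping action of $G$ on $X_G$. Let $\tau$ be a Polish topology on $X_G$ which is finer than or equal to the quotient topology, for which $\mathrm{Borel}(X_G,\tau)$ equals the quotient Borel structure of $X_G$, for which $\mathrm{Borel}(X)=\mathrm{Borel}(X,\tau_X)$ (where $X$ is identified with $\iota(X)\subseteq X_G$ and $\tau_X$ is the topology induced by $\tau$), and for which $\mu: G\times X_G\to X_G$ is Borel measurable with respect to $\mathrm{Borel}(X_G,\tau)$ (such a topology exists). Then the orbit equivalence relation $E^p_G$ of $m$ on $X$ is Borel bireducible to the orbit equivalence relation $E_G$ induced by the enveloping action $\mu$ of $G$ on $(X_G,\tau)$.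
   Context: A partial action of a group $G$ (identity $1$) on a set $X$ is a partially defined map $m: G\times X\to X$, $(g,x)\mapsto g\cdot x$, such that, writing $\exists g\cdot x$ to mean that $(g,x)$ is in the domain of $m$, for all $g,h\in G$ and $x\in X$: (PA1) if $\exists g\cdot x$ then $\exists g^{-1}\cdot(g\cdot x)$ and $g^{-1}\cdot(g\cdot x)=x$; (PA2) if $\exists g\cdot(h\cdot x)$ then $\exists (gh)\cdot x$ and $g\cdot(h\cdot x)=(gh)\cdot x$; (PA3) $\exists 1\cdot x$ and $1\cdot x=x$. Notation: $G*X=\{(g,x)\in G\times X:\exists g\cdot x\}$ (with the subspace topology from $G\times X$); $X_{g^{-1}}=\{x\in X:\exists g\cdot x\}$; $m_g: X_{g^{-1}}\to X_g$, $x\mapsto g\cdot x$ (a bijection). For $G$ a topological group and $X$ a topological space, the partial action is topological if each $X_g$ is open in $X$ and each $m_g$ is a homeomorphism; it is continuous if $m: G*X\to X$ is continuous. Orbit equivalence relation: $x\,E^p_G\,y$ iff there is $g\in G$ with $\exists g\cdot x$ and $g\cdot x=y$. For a global action it is denoted $E_G$. Enveloping space: define an equivalence relation $R$ on $G\times X$ by $(g,x)R(h,y)$ iff $x\in X_{g^{-1}h}$ and $m_{h^{-1}g}(x)=y$. Write $[g,x]$ for the class of $(g,x)$ and $X_G=(G\times X)/R$, with the quotient topology. The quotient Borel structure on $X_G$ consists of all $B\subseteq X_G$ whose preimage under the quotient map $G\times X\to X_G$ is Borel in $G\times X$. The enveloping action is $\mu: G\times X_G\to X_G$, $\mu(g,[h,x])=[gh,x]$.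 The map $\iota: X\to X_G$, $\iota(x)=[1,x]$, is injective. For equivalence relations $E$ on $X$ and $F$ on $Y$, a reduction of $E$ into $F$ is a map $f: X\to Y$ such that $xEy$ iff $f(x)Ff(y)$. $E$ and $F$ are Borel bireducible if there are Borel measurable reductions of $E$ into $F$ and of $F$ into $E$. A Polish space is a separable completely metrizable space; a Polish group is a topological group whose topology is Polish. $\mathrm{Borel}(Y,\sigma)$ denotes the $\sigma$-algebra generated by the $\sigma$-open sets. *)

theory Defs
  imports "HOL-Analysis.Analysis" "HOL-Algebra.Group"
begin

definition polish_topology :: "'a topology \<Rightarrow> bool" where
  "polish_topology T \<longleftrightarrow> completely_metrizable_space T \<and> separable_space T"

definition borel_of :: "'a topology \<Rightarrow> 'a measure" where
  "borel_of T = sigma (topspace T) {U. openin T U}"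

lemma space_borel_of [simp]: "space (borel_of T) = topspace T"
  unfolding borel_of_def by (rule space_measure_of) (auto dest: openin_subset)

lemma sets_borel_of: "sets (borel_of T) = sigma_sets (topspace T) {U. openin T U}"
  unfolding borel_of_def by (rule sets_measure_of) (auto dest: openin_subset)

text \<open>The next two notions are meant for an equivalence relation \<open>R\<close> on \<open>topspace T\<close>; the
  quotient map is \<open>\<lambda>p. R `` {p}\<close>.\<close>

definition quotient_topology :: "'a topology \<Rightarrow> ('a \<times> 'a) set \<Rightarrow> 'a set topology" where
  "quotient_topology T R =
     topology (\<lambda>U. U \<subseteq> topspace T // R \<and> openin T {p \<in> topspace T. R `` {p} \<in> U})"

definition quotient_borel :: "'a topology \<Rightarrow> ('a \<times> 'a) set \<Rightarrow> 'a set set set" where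
  "quotient_borel T R =
     {B. B \<subseteq> topspace T // R \<and> {p \<in> topspace T. R `` {p} \<in> B} \<in> sets (borel_of T)}"

lemma openin_quotient_topology:
  "openin (quotient_topology T R) U \<longleftrightarrow>
     U \<subseteq> topspace T // R \<and> openin T {p \<in> topspace T. R `` {p} \<in> U}"
proof -
  have "istopology (\<lambda>U. U \<subseteq> topspace T // R \<and> openin T {p \<in> topspace T. R `` {p} \<in> U})"
    unfolding istopology_def
  proof (intro conjI allI impI; (elim conjE)?)
    fix S S'
    assume "openin T {p \<in> topspace T. R `` {p} \<in> S}" "openin T {p \<in> topspace T. R `` {p} \<in> S'}"
    then have "openin T ({p \<in> topspace T. R `` {p} \<in> S} \<inter> {p \<in> topspace T. R `` {p} \<in> S'})"
      by blast
    also have "{p \<in> topspace T. R `` {p} \<in> S} \<inter> {p \<in> topspace T. R `` {p} \<in> S'}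
      = {p \<in> topspace T. R `` {p} \<in> S \<inter> S'}" by blast
    finally show "openin T {p \<in> topspace T. R `` {p} \<in> S \<inter> S'}" .
  next
    fix \<K>
    assume *: "\<forall>K\<in>\<K>. K \<subseteq> topspace T // R \<and> openin T {p \<in> topspace T. R `` {p} \<in> K}"
    then have "openin T (\<Union>K\<in>\<K>. {p \<in> topspace T. R `` {p} \<in> K})" by blast
    also have "(\<Union>K\<in>\<K>. {p \<in> topspace T. R `` {p} \<in> K}) = {p \<in> topspace T. R `` {p} \<in> \<Union>\<K>}"
      by blast
    finally show "openin T {p \<in> topspace T. R `` {p} \<in> \<Union>\<K>}" .
    show "\<Union>\<K> \<subseteq> topspace T // R" using * by blast
  qed blast
  then show ?thesis unfolding quotient_topology_def by simp
qed

lemma topspace_quotient_topology [simp]: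
  "topspace (quotient_topology T R) = topspace T // R"
proof
  show "topspace (quotient_topology T R) \<subseteq> topspace T // R"
    using openin_quotient_topology[of T R "topspace (quotient_topology T R)"] by simp
  have "{p \<in> topspace T. R `` {p} \<in> topspace T // R} = topspace T"
    by (auto intro: quotientI)
  then have "openin (quotient_topology T R) (topspace T // R)"
    by (simp add: openin_quotient_topology)
  then show "topspace T // R \<subseteq> topspace (quotient_topology T R)"
    by (rule openin_subset)
qed

lemma quotient_map_quotient_topology:
  "quotient_map T (quotient_topology T R) (\<lambda>p. R `` {p})"
  unfolding quotient_map_def by (auto simp: openin_quotient_topology quotient_def)

definition reduction :: "'a set \<Rightarrow> ('a \<times> 'a) set \<Rightarrow> ('b \<times> 'b) set \<Rightarrow> ('a \<Rightarrow> 'b) \<Rightarrow> bool" where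
  "reduction A E F f \<longleftrightarrow> (\<forall>x\<in>A. \<forall>y\<in>A. (x, y) \<in> E \<longleftrightarrow> (f x, f y) \<in> F)"

definition borel_reducible ::
    "'a topology \<Rightarrow> ('a \<times> 'a) set \<Rightarrow> 'b topology \<Rightarrow> ('b \<times> 'b) set \<Rightarrow> bool" where
  "borel_reducible S E T F \<longleftrightarrow>
     (\<exists>f \<in> borel_of S \<rightarrow>\<^sub>M borel_of T. reduction (topspace S) E F f)"

definition borel_bireducible ::
    "'a topology \<Rightarrow> ('a \<times> 'a) set \<Rightarrow> 'b topology \<Rightarrow> ('b \<times> 'b) set \<Rightarrow> bool" where
  "borel_bireducible S E T F \<longleftrightarrow> borel_reducible S E T F \<and> borel_reducible T F S E"

locale topological_group = group G for G (structure) +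
  fixes TG :: "'g topology"
  assumes topspace_eq: "topspace TG = carrier G"
    and continuous_mult: "continuous_map (prod_topology TG TG) TG (\<lambda>(g, h). g \<otimes> h)"
    and continuous_inv: "continuous_map TG TG (\<lambda>g. inv g)"

definition polish_group :: "('g, 'b) monoid_scheme \<Rightarrow> 'g topology \<Rightarrow> bool" where
  "polish_group G TG \<longleftrightarrow> topological_group G TG \<and> polish_topology TG"

text \<open>The partially defined map \<open>(g, x) \<mapsto> g \<cdot> x\<close> is an option-valued \<open>m\<close>; \<open>m g x = None\<close> means that
  \<open>g \<cdot> x\<close> is undefined, which includes all arguments outside \<open>G \<times> X\<close>.\<close>

locale partial_action = group G for G (structure) +
  fixes X :: "'x set" and m :: "'g \<Rightarrow> 'x \<Rightarrow> 'x option"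
  assumes typing: "m g x = Some y \<Longrightarrow> g \<in> carrier G \<and> x \<in> X \<and> y \<in> X"
    and PA1: "m g x = Some y \<Longrightarrow> m (inv g) y = Some x"
    and PA2: "m h x = Some y \<Longrightarrow> m g y = Some z \<Longrightarrow> m (g \<otimes> h) x = Some z"
    and PA3: "x \<in> X \<Longrightarrow> m \<one> x = Some x"

definition pa_dom :: "('g \<Rightarrow> 'x \<Rightarrow> 'x option) \<Rightarrow> ('g \<times> 'x) set" where
  "pa_dom m = {(g, x). m g x \<noteq> None}"

text \<open>\<open>pa_set G m g\<close> is \<open>X\<^sub>g\<close>, the set of all \<open>x\<close> such that \<open>g\<inverse> \<cdot> x\<close> is defined.\<close>

definition pa_set :: "('g, 'b) monoid_scheme \<Rightarrow> ('g \<Rightarrow> 'x \<Rightarrow> 'x option) \<Rightarrow> 'g \<Rightarrow> 'x set" where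
  "pa_set G m g = {x. m (inv\<^bsub>G\<^esub> g) x \<noteq> None}"

definition pa_map :: "('g \<Rightarrow> 'x \<Rightarrow> 'x option) \<Rightarrow> 'g \<Rightarrow> 'x \<Rightarrow> 'x" where
  "pa_map m g x = the (m g x)"

definition topological_partial_action ::
    "('g, 'b) monoid_scheme \<Rightarrow> 'x topology \<Rightarrow> ('g \<Rightarrow> 'x \<Rightarrow> 'x option) \<Rightarrow> bool" where
  "topological_partial_action G TX m \<longleftrightarrow>
     partial_action G (topspace TX) m \<and>
     (\<forall>g\<in>carrier G.
        openin TX (pa_set G m g) \<and>
        homeomorphic_map (subtopology TX (pa_set G m (inv\<^bsub>G\<^esub> g))) (subtopology TX (pa_set G m g))
          (pa_map m g))"

definition continuous_partial_action ::
    "'g topology \<Rightarrow> 'x topology \<Rightarrow> ('g \<Rightarrow> 'x \<Rightarrow> 'x option) \<Rightarrow> bool" where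
  "continuous_partial_action TG TX m \<longleftrightarrow>
     continuous_map (subtopology (prod_topology TG TX) (pa_dom m)) TX (\<lambda>(g, x). pa_map m g x)"

definition pa_orbit_rel :: "('g \<Rightarrow> 'x \<Rightarrow> 'x option) \<Rightarrow> ('x \<times> 'x) set" where
  "pa_orbit_rel m = {(x, y). \<exists>g. m g x = Some y}"

definition orbit_rel ::
    "('g, 'b) monoid_scheme \<Rightarrow> 'y set \<Rightarrow> ('g \<Rightarrow> 'y \<Rightarrow> 'y) \<Rightarrow> ('y \<times> 'y) set" where
  "orbit_rel G Y a = {(x, y). x \<in> Y \<and> y \<in> Y \<and> (\<exists>g\<in>carrier G. a g x = y)}"

definition env_rel ::
    "('g, 'b) monoid_scheme \<Rightarrow> 'x set \<Rightarrow> ('g \<Rightarrow> 'x \<Rightarrow> 'x option) \<Rightarrow> (('g \<times> 'x) \<times> ('g \<times> 'x)) set" where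
  "env_rel G X m =
     {((g, x), (h, y)). (g, x) \<in> carrier G \<times> X \<and> (h, y) \<in> carrier G \<times> X \<and>
        x \<in> pa_set G m (inv\<^bsub>G\<^esub> g \<otimes>\<^bsub>G\<^esub> h) \<and> pa_map m (inv\<^bsub>G\<^esub> h \<otimes>\<^bsub>G\<^esub> g) x = y}"

definition env_class ::
    "('g, 'b) monoid_scheme \<Rightarrow> 'x set \<Rightarrow> ('g \<Rightarrow> 'x \<Rightarrow> 'x option) \<Rightarrow> 'g \<Rightarrow> 'x \<Rightarrow> ('g \<times> 'x) set" where
  "env_class G X m g x = env_rel G X m `` {(g, x)}"

definition env_space ::
    "('g, 'b) monoid_scheme \<Rightarrow> 'x set \<Rightarrow> ('g \<Rightarrow> 'x \<Rightarrow> 'x option) \<Rightarrow> ('g \<times> 'x) set set" where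
  "env_space G X m = (carrier G \<times> X) // env_rel G X m"

definition env_emb ::
    "('g, 'b) monoid_scheme \<Rightarrow> 'x set \<Rightarrow> ('g \<Rightarrow> 'x \<Rightarrow> 'x option) \<Rightarrow> 'x \<Rightarrow> ('g \<times> 'x) set" where
  "env_emb G X m x = env_class G X m \<one>\<^bsub>G\<^esub> x"

text \<open>All sets in the union below coincide, see \<open>env_act_class\<close>.\<close>

definition env_act ::
    "('g, 'b) monoid_scheme \<Rightarrow> 'x set \<Rightarrow> ('g \<Rightarrow> 'x \<Rightarrow> 'x option) \<Rightarrow>
     'g \<Rightarrow> ('g \<times> 'x) set \<Rightarrow> ('g \<times> 'x) set" where
  "env_act G X m g C = (\<Union>(h, x)\<in>C. env_class G X m (g \<otimes>\<^bsub>G\<^esub> h) x)"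

context partial_action
begin

lemma inv_cancel:
  assumes "a \<in> carrier G" "b \<in> carrier G"
  shows "a \<otimes> (inv a \<otimes> b) = b" "inv a \<otimes> (a \<otimes> b) = b"
  using assms by (simp_all flip: m_assoc)

lemma env_rel_iff:
  "((g, x), (h, y)) \<in> env_rel G X m \<longleftrightarrow>
     g \<in> carrier G \<and> h \<in> carrier G \<and> m (inv h \<otimes> g) x = Some y"
proof -
  have "inv (inv g \<otimes> h) = inv h \<otimes> g" if "g \<in> carrier G" "h \<in> carrier G"
    using that by (simp add: inv_mult_group)
  then show ?thesis
    using typing by (auto simp: env_rel_def pa_set_def pa_map_def)
qed

lemma equiv_env_rel: "equiv (carrier G \<times> X) (env_rel G X m)"
proof (rule equivI)
  show "env_rel G X m \<subseteq> (carrier G \<times> X) \<times> (carrier G \<times> X)"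
    by (auto simp: env_rel_def)
  show "refl_on (carrier G \<times> X) (env_rel G X m)"
    by (auto simp: refl_on_def env_rel_iff PA3)
  show "sym (env_rel G X m)"
  proof (rule symI, clarify)
    fix g x h y assume *: "((g, x), (h, y)) \<in> env_rel G X m"
    then have "m (inv (inv h \<otimes> g)) y = Some x" by (auto simp: env_rel_iff intro: PA1)
    then show "((h, y), (g, x)) \<in> env_rel G X m"
      using * by (simp add: env_rel_iff inv_mult_group)
  qed
  show "trans (env_rel G X m)"
  proof (rule transI, clarify)
    fix g x h y k z
    assume *: "((g, x), (h, y)) \<in> env_rel G X m" "((h, y), (k, z)) \<in> env_rel G X m"
    then have gr: "g \<in> carrier G" "h \<in> carrier G" "k \<in> carrier G" by (auto simp: env_rel_iff)
    have "(inv k \<otimes> h) \<otimes> (inv h \<otimes> g) = inv k \<otimes> g"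
      using gr by (simp add: m_assoc inv_cancel)
    then show "((g, x), (k, z)) \<in> env_rel G X m"
      using * PA2 gr by (fastforce simp: env_rel_iff)
  qed
qed

lemma env_act_class:
  assumes "g \<in> carrier G" "h \<in> carrier G" "x \<in> X"
  shows "env_act G X m g (env_class G X m h x) = env_class G X m (g \<otimes> h) x"
proof -
  have "env_class G X m (g \<otimes> k) y = env_class G X m (g \<otimes> h) x"
    if "(k, y) \<in> env_class G X m h x" for k y
  proof -
    have r: "((h, x), (k, y)) \<in> env_rel G X m" using that by (simp add: env_class_def)
    then have k: "k \<in> carrier G" by (simp add: env_rel_iff)
    have "inv (g \<otimes> k) \<otimes> (g \<otimes> h) = inv k \<otimes> h"
      using assms k by (simp add: inv_mult_group m_assoc inv_cancel)
    then have "((g \<otimes> h, x), (g \<otimes> k, y)) \<in> env_rel G X m"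
      using r assms k by (simp add: env_rel_iff)
    then show ?thesis
      unfolding env_class_def using equiv_class_eq[OF equiv_env_rel] by metis
  qed
  moreover have "(h, x) \<in> env_class G X m h x"
    using assms by (simp add: env_class_def env_rel_iff PA3)
  ultimately show ?thesis unfolding env_act_def by fast
qed

end

end

theory Submission
  imports Defs
begin

text \<open>
  The embedding \<open>\<iota>\<close> is one reduction. For the other one it suffices to choose, in a Borel way, a
  representative \<open>(g, x)\<close> of every point of \<open>X\<^sub>G\<close>, and to map the point to \<open>x\<close>. The classes of the
  enveloping relation are \<open>G\<^sub>\<delta>\<close> sets, and saturations of open sets are open, so the set of
  classes that meet a given open set is open in the quotient topology.

  A representative of a class \<open>C\<close> is the limit of a shrinking sequence of basic open sets that meet
  \<open>C\<close>, each being the first one in an enumeration \<open>U\<^sub>0, U\<^sub>1, \<dots>\<close> of the base that is admissible.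
  Such a limit \<open>p\<close> lies in the closure of \<open>C\<close>. If \<open>C\<close> meets \<open>U\<^sub>n\<close>, then the sets chosen after step
  \<open>n\<close> are required to lie in the saturation of \<open>U\<^sub>n\<close>; hence the class of \<open>p\<close> meets every open set that
  \<open>C\<close> meets. So the two classes are dense \<open>G\<^sub>\<delta>\<close> subsets of the same closed set, and by Baire's theorem
  they coincide.
\<close>

section \<open>Borel maps and second countability\<close>

lemma measurable_borel_of_continuous_map:
  assumes "continuous_map S T f"
  shows "f \<in> borel_of S \<rightarrow>\<^sub>M borel_of T"
proof -
  have "f \<in> borel_of S \<rightarrow>\<^sub>M sigma (topspace T) {U. openin T U}"
  proof (rule measurable_measure_of)
    show "{U. openin T U} \<subseteq> Pow (topspace T)" by (auto dest: openin_subset)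
    show "f \<in> space (borel_of S) \<rightarrow> topspace T"
      using assms by (simp add: continuous_map_def)
    fix U assume "U \<in> {U. openin T U}"
    then have "openin S {x \<in> topspace S. f x \<in> U}"
      using assms by (simp add: continuous_map_def)
    moreover have "f -` U \<inter> space (borel_of S) = {x \<in> topspace S. f x \<in> U}" by auto
    ultimately show "f -` U \<inter> space (borel_of S) \<in> sets (borel_of S)"
      by (simp add: sets_borel_of)
  qed
  then show ?thesis by (simp add: borel_of_def)
qed

text \<open>The balls of radius \<open>1 / (n + 1)\<close> about the points of a countable dense set
  form a base: a radius below \<open>r / 2\<close> keeps such a ball inside the
  \<open>r\<close>-ball about any of its points.\<close>

lemma (in Metric_space) separable_imp_second_countable:
  assumes "separable_space mtopology"
  shows "second_countable mtopology"
proof -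
  obtain D where D: "countable D" "D \<subseteq> M" "mtopology closure_of D = M"
    using assms by (auto simp: separable_space_def)
  let ?B = "(\<lambda>(x, n). mball x (inverse (real (Suc n)))) ` (D \<times> UNIV)"
  show ?thesis
    unfolding second_countable_def
  proof (intro exI[of _ ?B] conjI allI impI)
    show "countable ?B" using D by blast
    show "\<forall>V\<in>?B. openin mtopology V" by auto
    fix U x assume U: "openin mtopology U \<and> x \<in> U"
    then obtain r where r: "r > 0" "mball x r \<subseteq> U" and x: "x \<in> M"
      unfolding openin_mtopology by blast
    obtain n where n: "inverse (real (Suc n)) < r / 2"
      using reals_Archimedean[of "r / 2"] r by auto
    let ?e = "inverse (real (Suc n))"
    have "x \<in> mtopology closure_of D" using D x by simp
    then obtain y where y: "y \<in> D" "y \<in> mball x ?e"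
      unfolding metric_closure_of by (blast intro: positive_imp_inverse_positive of_nat_0_less_iff[THEN iffD2])
    have "x \<in> mball y ?e" using y x by (simp add: commute)
    moreover have "mball y ?e \<subseteq> U"
    proof
      fix z assume z: "z \<in> mball y ?e"
      then have "d x z \<le> d x y + d y z" using y x by (auto intro: triangle)
      then have "d x z < r" using z y n by (auto simp del: of_nat_Suc)
      then show "z \<in> U" using r z x by auto
    qed
    ultimately show "\<exists>V\<in>?B. x \<in> V \<and> V \<subseteq> U" using y(1) by auto
  qed
qed

lemma polish_imp_second_countable:
  "polish_topology T \<Longrightarrow> second_countable T"
  unfolding polish_topology_def completely_metrizable_space_def
  by (auto intro: Metric_space.separable_imp_second_countable)

lemma second_countable_prod_topology:
  assumes "second_countable S" "second_countable T"
  shows "second_countable (prod_topology S T)"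
proof -
  obtain A where A: "countable A" "\<And>V. V \<in> A \<Longrightarrow> openin S V"
    "\<And>U x. openin S U \<Longrightarrow> x \<in> U \<Longrightarrow> \<exists>V\<in>A. x \<in> V \<and> V \<subseteq> U"
    using assms(1) by (auto simp: second_countable_def)
  obtain B where B: "countable B" "\<And>V. V \<in> B \<Longrightarrow> openin T V"
    "\<And>U x. openin T U \<Longrightarrow> x \<in> U \<Longrightarrow> \<exists>V\<in>B. x \<in> V \<and> V \<subseteq> U"
    using assms(2) by (auto simp: second_countable_def)
  let ?C = "(\<lambda>(U, V). U \<times> V) ` (A \<times> B)"
  show ?thesis
    unfolding second_countable_def
  proof (intro exI[of _ ?C] conjI allI impI)
    show "countable ?C" using A B by blast
    show "\<forall>V\<in>?C. openin (prod_topology S T) V"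
      using A B by (auto simp: openin_prod_Times_iff)
    fix W p assume W: "openin (prod_topology S T) W \<and> p \<in> W"
    obtain x y where p: "p = (x, y)" by (cases p)
    then obtain U V where UV: "openin S U" "openin T V" "x \<in> U" "y \<in> V" "U \<times> V \<subseteq> W"
      using W by (force simp: openin_prod_topology_alt)
    obtain U' where "U' \<in> A" "x \<in> U'" "U' \<subseteq> U" using A(3) UV by blast
    moreover obtain V' where "V' \<in> B" "y \<in> V'" "V' \<subseteq> V" using B(3) UV by blast
    ultimately have "U' \<times> V' \<in> ?C" "p \<in> U' \<times> V'" "U' \<times> V' \<subseteq> W"
      using UV(5) p by auto
    then show "\<exists>V\<in>?C. p \<in> V \<and> V \<subseteq> W" by blast
  qed
qed

section \<open>G-delta sets and Baire category\<close>

lemma gdelta_in_continuous_map_preimage: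
  assumes "continuous_map S T f" "gdelta_in T A"
  shows "gdelta_in S {x \<in> topspace S. f x \<in> A}"
proof -
  obtain C where C: "\<And>n::nat. openin T (C n)" "\<And>n. C (Suc n) \<subseteq> C n" "\<Inter>(range C) = A"
    using assms(2) by (auto simp: gdelta_in_descending)
  show ?thesis
    unfolding gdelta_in_descending
  proof (intro exI conjI allI)
    fix n
    show "openin S {x \<in> topspace S. f x \<in> C n}"
      using assms(1) C by (simp add: continuous_map_def)
    show "{x \<in> topspace S. f x \<in> C (Suc n)} \<subseteq> {x \<in> topspace S. f x \<in> C n}"
      using C(2) by blast
    show "(\<Inter>n. {x \<in> topspace S. f x \<in> C n}) = {x \<in> topspace S. f x \<in> A}"
      using C(3) by auto
  qed
qed

text \<open>The common closure is closed, hence completely metrizable, and the open sets whose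
  intersections are \<open>C\<close> and \<open>D\<close> have dense traces on it. By Baire's
  theorem \<open>C \<inter> D\<close> is dense there.\<close>

lemma gdelta_in_dense_Int_nonempty:
  assumes "completely_metrizable_space T" "gdelta_in T C" "gdelta_in T D"
    and eq: "T closure_of C = T closure_of D" and "C \<noteq> {}"
  shows "C \<inter> D \<noteq> {}"
proof -
  let ?F = "T closure_of C" and ?Y = "subtopology T (T closure_of C)"
  have sub: "C \<subseteq> topspace T" "D \<subseteq> topspace T" using assms(2,3) by (auto dest: gdelta_in_subset)
  have CF: "C \<subseteq> ?F" "D \<subseteq> ?F" using sub eq closure_of_subset by (metis)+
  obtain c where c: "\<And>n::nat. openin T (c n)" "\<Inter>(range c) = C"
    using assms(2) by (auto simp: gdelta_in_descending)
  obtain e where e: "\<And>n::nat. openin T (e n)" "\<Inter>(range e) = D"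
    using assms(3) by (auto simp: gdelta_in_descending)
  have top: "topspace ?Y = ?F" by (simp add: closure_of_subset_topspace inf.absorb2)
  have dense: "?Y closure_of (W \<inter> ?F) = topspace ?Y" if "E \<subseteq> W" "E \<subseteq> ?F" "T closure_of E = ?F" for W E
  proof
    have "?F \<subseteq> T closure_of (W \<inter> ?F)" using that closure_of_mono[of E "W \<inter> ?F" T] by blast
    then show "topspace ?Y \<subseteq> ?Y closure_of (W \<inter> ?F)"
      unfolding top by (simp add: closure_of_subtopology Int_absorb1)
  qed (rule closure_of_subset_topspace)
  let ?G = "range (\<lambda>n. c n \<inter> ?F) \<union> range (\<lambda>n. e n \<inter> ?F)"
  have "?Y closure_of \<Inter>?G = topspace ?Y"
  proof (rule Baire_category)
    show "completely_metrizable_space ?Y \<or> locally_compact_space ?Y \<and> regular_space ?Y"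
      using assms(1) by (simp add: completely_metrizable_space_closedin)
    show "countable ?G" by simp
    fix V assume "V \<in> ?G"
    then consider n where "V = c n \<inter> ?F" | n where "V = e n \<inter> ?F" by blast
    then show "openin ?Y V \<and> ?Y closure_of V = topspace ?Y"
    proof cases
      case 1
      have "C \<subseteq> c n" using c(2) by blast
      then show ?thesis unfolding 1
        using dense[OF _ CF(1) refl] openin_subtopology_Int[OF c(1)] by blast
    next
      case 2
      have "D \<subseteq> e n" using e(2) by blast
      then show ?thesis unfolding 2
        using dense[OF _ CF(2) eq[symmetric]] openin_subtopology_Int[OF e(1)] by blast
    qed
  qed
  moreover have "\<Inter>?G \<subseteq> C \<inter> D" using c(2) e(2) by auto
  ultimately show ?thesis using CF top \<open>C \<noteq> {}\<close> by (metis closure_of_empty subset_empty)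
qed


section \<open>Borel choice of representatives\<close>

text \<open>The conditions on \<open>p\<close> put each of \<open>C\<close> and the class
  \<open>D\<close> of \<open>p\<close> into the closure of the other. Having equal closures, the two
  G-delta classes intersect, and intersecting classes are equal.\<close>

lemma mem_class_if_dense_in_class:
  assumes T: "completely_metrizable_space T" and R: "equiv (topspace T) R"
    and gd: "\<And>C. C \<in> topspace T // R \<Longrightarrow> gdelta_in T C"
    and sat: "\<And>U. openin T U \<Longrightarrow> openin T (R `` U)"
    and C: "C \<in> topspace T // R"
    and p: "p \<in> T closure_of C" "\<And>U. openin T U \<Longrightarrow> C \<inter> U \<noteq> {} \<Longrightarrow> p \<in> R `` U"
  shows "p \<in> C"
proof -
  define D where "D = R `` {p}"
  have pT: "p \<in> topspace T" using p(1) by (rule in_closure_of[THEN iffD1, THEN conjunct1])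
  then have D: "D \<in> topspace T // R" by (auto simp: D_def quotient_def)
  have sub: "C \<subseteq> topspace T" "D \<subseteq> topspace T" using gd C D by (auto dest: gdelta_in_subset)
  have symR: "sym R" and transR: "trans R" using R by (auto simp: equiv_def)
  have C_cl: "y \<in> C" if "x \<in> C" "(x, y) \<in> R" for x y
    by (rule in_quotient_imp_closed[OF R C that])
  \<comment> \<open>If \<open>W\<close> is an open neighbourhood of a point of \<open>D\<close>, its
    saturation is an open neighbourhood of \<open>p\<close> and so meets \<open>C\<close>. As
    \<open>C\<close> is a class, \<open>W\<close> itself then meets \<open>C\<close>.\<close>
  have "D \<subseteq> T closure_of C"
  proof
    fix d assume d: "d \<in> D"
    have "\<exists>c. c \<in> C \<and> c \<in> W" if W: "d \<in> W" "openin T W" for W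
    proof -
      have "(d, p) \<in> R" using d symR by (auto simp: D_def dest: symD)
      then have "p \<in> R `` W" using W by blast
      then obtain c where c: "c \<in> C" "c \<in> R `` W"
        using p(1) sat[OF W(2)] unfolding in_closure_of by blast
      then obtain w where w: "w \<in> W" "(w, c) \<in> R" by blast
      then have "w \<in> C" using C_cl[OF c(1)] symR by (blast dest: symD)
      then show ?thesis using w(1) by blast
    qed
    then show "d \<in> T closure_of C" using d sub by (auto simp: in_closure_of)
  qed
  moreover have "C \<subseteq> T closure_of D"
  proof
    fix c assume c: "c \<in> C"
    have "\<exists>d. d \<in> D \<and> d \<in> W" if W: "c \<in> W" "openin T W" for W
    proof -
      have "p \<in> R `` W" using p(2)[OF W(2)] c W(1) by blast
      then show ?thesis using symR by (auto simp: D_def dest: symD)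
    qed
    then show "c \<in> T closure_of D" using c sub by (auto simp: in_closure_of)
  qed
  ultimately have "T closure_of C = T closure_of D"
    by (simp add: closure_of_minimal_eq closure_of_minimal subset_antisym)
  moreover have "C \<noteq> {}" using C R by (metis in_quotient_imp_non_empty)
  ultimately have "C \<inter> D \<noteq> {}"
    using gdelta_in_dense_Int_nonempty[OF T gd[OF C] gd[OF D]] by blast
  then have "C = D" using quotient_disj[OF R C D] by blast
  then show ?thesis using equiv_class_self[OF R pT] by (simp add: D_def)
qed

text \<open>Every choice takes a least index, and whether an index is admissible at a given stage,
  after a given previous index, depends on the class only through the basic open sets that it meets.
  By \<open>hit\<close> these conditions are measurable. The measure space \<open>M\<close> stays
  abstract so that \<open>borel_of \<tau>\<close> can be inserted later.\<close>

lemma borel_selector: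
  assumes T: "completely_metrizable_space T" "second_countable T"
    and R: "equiv (topspace T) R"
    and gd: "\<And>C. C \<in> topspace T // R \<Longrightarrow> gdelta_in T C"
    and sat: "\<And>U. openin T U \<Longrightarrow> openin T (R `` U)"
    and M: "space M = topspace T // R"
    and hit: "\<And>U. openin T U \<Longrightarrow> {C \<in> topspace T // R. C \<inter> U \<noteq> {}} \<in> sets M"
  obtains s where "s \<in> M \<rightarrow>\<^sub>M borel_of T" "\<And>C. C \<in> topspace T // R \<Longrightarrow> s C \<in> C"
proof -
  obtain S d where S: "Metric_space S d" "Metric_space.mcomplete S d" "T = Metric_space.mtopology S d"
    using T(1) by (auto simp: completely_metrizable_space_def)
  interpret Metric_space S d by (rule S)
  have topT: "topspace T = S" by (simp add: S(3))
  obtain \<B> where \<B>: "countable \<B>" "\<And>V. V \<in> \<B> \<Longrightarrow> openin T V"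
    "\<And>U x. openin T U \<Longrightarrow> x \<in> U \<Longrightarrow> \<exists>V\<in>\<B>. x \<in> V \<and> V \<subseteq> U"
    using T(2) by (auto simp: second_countable_def)
  \<comment> \<open>The whole space is added to the base: every class meets it, so the recursion can
    start there. It also makes the enumerated family nonempty.\<close>
  define U where "U = from_nat_into (insert (topspace T) \<B>)"
  have rU: "range U = insert (topspace T) \<B>"
    using \<B>(1) by (simp add: U_def range_from_nat_into)
  have Uo: "openin T (U k)" for k using \<B>(2) rU by (metis insertE openin_topspace rangeI)
  have Us: "U k \<subseteq> topspace T" for k by (rule openin_subset[OF Uo])
  have Uc: "U k \<subseteq> T closure_of U k" for k by (rule closure_of_subset[OF Us])
  have Ub: "\<exists>k. x \<in> U k \<and> U k \<subseteq> W" if "openin T W" "x \<in> W" for W x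
    using \<B>(3)[OF that] rU by (metis imageE insertI2)
  obtain k0 where k0: "U k0 = topspace T" using rU by (metis imageE insertI1)

  \<comment> \<open>\<open>k\<close> may follow \<open>j\<close> at stage \<open>n\<close>. The
    clauses make the sets nested together with their closures, make them shrink to a point, keep
    them meeting \<open>C\<close>, and force the limit into the saturation of \<open>U n\<close>
    whenever \<open>C\<close> meets \<open>U n\<close>.\<close>
  define step where "step n j C k \<longleftrightarrow> T closure_of U k \<subseteq> U j
    \<and> (\<exists>x. U k \<subseteq> mcball x (inverse (real (Suc n))))
    \<and> C \<inter> U k \<noteq> {} \<and> (C \<inter> U n \<noteq> {} \<longrightarrow> U k \<subseteq> R `` U n)" for n j C k
  define K where "K = rec_nat (\<lambda>C. k0) (\<lambda>n f C. LEAST k. step n (f C) C k)"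
  have K0: "K 0 C = k0" and KS: "K (Suc n) C = (LEAST k. step n (K n C) C k)" for n C
    by (simp_all add: K_def)
  have ex: "\<exists>k. step n j C k" if C: "C \<in> topspace T // R" and j: "C \<inter> U j \<noteq> {}" for n j C
  proof -
    obtain p where p: "p \<in> C" "p \<in> U j" using j by blast
    have pS: "p \<in> S" using p Us topT by blast
    \<comment> \<open>\<open>W\<close> collects the demands of \<open>step\<close> around
      \<open>p\<close>. It contains \<open>p\<close> because all of \<open>C\<close> lies in the
      saturation of \<open>U n\<close> once \<open>C\<close> meets \<open>U n\<close>. Regularity
      then yields a basic set about \<open>p\<close> whose closure lies in \<open>W\<close>.\<close>
    define W where "W = U j \<inter> mball p (inverse (real (Suc n)))
      \<inter> (if C \<inter> U n \<noteq> {} then R `` U n else topspace T)"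
    have "openin T (mball p (inverse (real (Suc n))))" by (simp add: S(3))
    then have Wo: "openin T W" using Uo sat by (auto simp: W_def)
    have "p \<in> R `` U n" if hitn: "C \<inter> U n \<noteq> {}"
    proof -
      obtain c where c: "c \<in> C" "c \<in> U n" using hitn by blast
      then have "(c, p) \<in> R" using in_quotient_imp_in_rel[OF R C] p(1) by blast
      then show ?thesis using c by blast
    qed
    then have pW: "p \<in> W" using p pS by (simp add: W_def topT)
    have "regular_space T"
      using T(1) completely_metrizable_imp_metrizable_space metrizable_imp_regular_space by blast
    moreover have "closedin T (topspace T - W)" "p \<in> topspace T - (topspace T - W)"
      using Wo pW pS topT by auto
    ultimately obtain V where V: "openin T V" "p \<in> V" "disjnt (topspace T - W) (T closure_of V)"
      unfolding regular_space by blast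
    obtain k where k: "p \<in> U k" "U k \<subseteq> V" using Ub V by blast
    have "T closure_of U k \<subseteq> T closure_of V" using k closure_of_mono by blast
    then have cl: "T closure_of U k \<subseteq> W"
      using V(3) closure_of_subset_topspace[of T V] by (auto simp: disjnt_iff)
    have UkW: "U k \<subseteq> W" using Uc cl by (rule order_trans)
    have "step n j C k"
      unfolding step_def
    proof (intro conjI impI exI)
      show "T closure_of U k \<subseteq> U j" using cl by (auto simp: W_def)
      show "U k \<subseteq> mcball p (inverse (real (Suc n)))"
        using UkW mball_subset_mcball by (auto simp: W_def)
      show "C \<inter> U k \<noteq> {}" using p k by blast
      show "U k \<subseteq> R `` U n" if "C \<inter> U n \<noteq> {}" using UkW that by (auto simp: W_def)
    qed
    then show ?thesis ..
  qed
  \<comment> \<open>This invariant guarantees that an admissible index exists at every stage, so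
    that \<open>LEAST\<close> really satisfies \<open>step\<close>.\<close>
  have meets: "C \<inter> U (K n C) \<noteq> {}" if "C \<in> topspace T // R" for n C
  proof (induction n)
    case 0
    then show ?case
      using that k0 in_quotient_imp_non_empty[OF R that] in_quotient_imp_subset[OF R that]
      by (auto simp: K0)
  next
    case (Suc n)
    then show ?case using LeastI_ex[OF ex[OF that Suc]] unfolding KS step_def by blast
  qed
  have stepK: "step n (K n C) C (K (Suc n) C)" if "C \<in> topspace T // R" for n C
    unfolding KS by (rule LeastI_ex[OF ex[OF that meets[OF that]]])

  have "\<exists>p. \<forall>n. p \<in> U (K n C)" if C: "C \<in> topspace T // R" for C
  proof -
    \<comment> \<open>The index starts at \<open>Suc n\<close> because the first set is the whole
      space, with no bound on its size. Each closure lies in the previous open set, so a point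
      common to all closures lies in all chosen open sets.\<close>
    let ?F = "\<lambda>n. T closure_of U (K (Suc n) C)"
    have "\<Inter>(range ?F) \<noteq> {}"
    proof (rule S(2)[unfolded mcomplete_nest, rule_format], intro conjI allI impI)
      fix n
      show "closedin mtopology (?F n)" using S(3) by simp
      have sub: "U (K (Suc n) C) \<subseteq> ?F n" for n by (rule Uc)
      then show "?F n \<noteq> {}" using meets[OF C] by blast
      have "?F (Suc n) \<subseteq> ?F n" for n
        using stepK[OF C, of "Suc n"] sub[of n] unfolding step_def by blast
      then show "decseq ?F" by (rule decseq_SucI)
      fix \<epsilon> :: real assume "\<epsilon> > 0"
      then obtain n where n: "inverse (real (Suc n)) < \<epsilon>" using reals_Archimedean by blast
      obtain x where "U (K (Suc n) C) \<subseteq> mcball x (inverse (real (Suc n)))"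
        using stepK[OF C, of n] unfolding step_def by blast
      then have "?F n \<subseteq> mcball x (inverse (real (Suc n)))"
        by (simp add: S(3) closure_of_minimal)
      also have "\<dots> \<subseteq> mcball x \<epsilon>" using n by (intro mcball_subset_concentric) simp
      finally show "\<exists>n a. ?F n \<subseteq> mcball a \<epsilon>" by blast
    qed
    then obtain p where "\<And>n. p \<in> ?F n" by blast
    then have "p \<in> U (K n C)" for n using stepK[OF C, of n] unfolding step_def by blast
    then show ?thesis by blast
  qed
  then obtain s where s: "\<And>C n. C \<in> topspace T // R \<Longrightarrow> s C \<in> U (K n C)" by metis
  \<comment> \<open>The chosen sets form a neighbourhood base at \<open>s C\<close>: two points of a
    closed ball of radius below \<open>r / 2\<close> are less than \<open>r\<close> apart.\<close>
  have small: "\<exists>n. U (K n C) \<subseteq> W" if C: "C \<in> topspace T // R" and W: "openin T W" "s C \<in> W" for C W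
  proof -
    obtain r where r: "r > 0" "mball (s C) r \<subseteq> W" using W unfolding S(3) openin_mtopology by blast
    obtain n where n: "inverse (real (Suc n)) < r / 2" using reals_Archimedean[of "r / 2"] r by auto
    obtain x where x: "U (K (Suc n) C) \<subseteq> mcball x (inverse (real (Suc n)))"
      using stepK[OF C, of n] unfolding step_def by blast
    have "U (K (Suc n) C) \<subseteq> mball (s C) r"
    proof
      fix y assume "y \<in> U (K (Suc n) C)"
      then have y: "y \<in> mcball x (inverse (real (Suc n)))" using x by blast
      have sC: "s C \<in> mcball x (inverse (real (Suc n)))" using s[OF C] x by blast
      have "d (s C) y \<le> d x (s C) + d x y" using y sC triangle''[of "s C" x y]
        by (simp add: triangle' commute del: of_nat_Suc)
      then have "d (s C) y < r" using y sC n by (auto simp del: of_nat_Suc)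
      then show "y \<in> mball (s C) r" using y sC by simp
    qed
    then show ?thesis using r by blast
  qed

  have "s C \<in> C" if C: "C \<in> topspace T // R" for C
  proof (rule mem_class_if_dense_in_class[OF T(1) R gd sat C])
    have "s C \<in> topspace T" using s[OF C, of 0] Us by blast
    then show "s C \<in> T closure_of C"
      using small[OF C] meets[OF C] by (fastforce simp: in_closure_of)
    \<comment> \<open>The index of a basic set is also the stage that handles it: if
      \<open>C\<close> meets \<open>U n\<close>, the set chosen at stage \<open>n\<close>, and with
      it \<open>s C\<close>, lies in the saturation of \<open>U n\<close>.\<close>
    fix W assume W: "openin T W" "C \<inter> W \<noteq> {}"
    then obtain n where n: "C \<inter> U n \<noteq> {}" "U n \<subseteq> W" using Ub by blast
    then show "s C \<in> R `` W" using stepK[OF C, of n] s[OF C, of "Suc n"] unfolding step_def by blast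
  qed
  moreover have "s \<in> M \<rightarrow>\<^sub>M borel_of T"
  proof -
    have hitm: "Measurable.pred M (\<lambda>C. C \<inter> U k \<noteq> {})" for k
      using hit[OF Uo[of k]] by (simp add: pred_def M)
    have Km: "K n \<in> M \<rightarrow>\<^sub>M count_space UNIV" for n
    proof (induction n)
      case 0
      have "K 0 = (\<lambda>C. k0)" by (simp add: fun_eq_iff K0)
      then show ?case by simp
    next
      case (Suc n)
      \<comment> \<open>For fixed \<open>j\<close> and \<open>k\<close> only the conditions of
        meeting \<open>U k\<close> and \<open>U n\<close> vary with \<open>C\<close>. Replacing
        \<open>j\<close> by the countably valued \<open>K n C\<close> then preserves
        measurability.\<close>
      have "Measurable.pred M (\<lambda>C. step n j C k)" for j k
        unfolding step_def using hitm by measurable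
      then have "Measurable.pred M (\<lambda>C. step n (K n C) C k)" for k
        using Suc by (rule measurable_compose_countable)
      then have "(\<lambda>C. LEAST k. step n (K n C) C k) \<in> M \<rightarrow>\<^sub>M count_space UNIV"
        by (rule measurable_Least)
      moreover have "K (Suc n) = (\<lambda>C. LEAST k. step n (K n C) C k)" by (simp add: fun_eq_iff KS)
      ultimately show ?case by simp
    qed
    have "s \<in> M \<rightarrow>\<^sub>M sigma (topspace T) {U. openin T U}"
    proof (rule measurable_measure_of)
      show "{U. openin T U} \<subseteq> Pow (topspace T)" by (auto dest: openin_subset)
      show "s \<in> space M \<rightarrow> topspace T"
        using s[of _ 0] Us M by blast
      fix W assume "W \<in> {U. openin T U}"
      then have W: "openin T W" by simp
      \<comment> \<open>Membership of the limit in an open set is decided at a finite stage, which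
        makes the preimage a countable union.\<close>
      have "s C \<in> W \<longleftrightarrow> (\<exists>n. U (K n C) \<subseteq> W)" if "C \<in> space M" for C
        using small[OF that[unfolded M] W] s[OF that[unfolded M]] by (meson subsetD)
      then have "s -` W \<inter> space M = (\<Union>n. K n -` {k. U k \<subseteq> W} \<inter> space M)" by auto
      also have "\<dots> \<in> sets M" by (intro sets.countable_UN image_subsetI measurable_sets[OF Km]) simp
      finally show "s -` W \<inter> space M \<in> sets M" .
    qed
    then show ?thesis by (simp add: borel_of_def)
  qed
  ultimately show thesis by (intro that)
qed


section \<open>Topology of the enveloping relation on \<open>G \<times> X\<close>\<close>

text \<open>The points equivalent to \<open>(h, y)\<close> are exactly the pairs
  \<open>(h k, k^{-1} y)\<close> with \<open>y\<close> in \<open>X_k\<close>. Hence the saturation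
  of \<open>W\<close> is the union over \<open>k\<close> of preimages of \<open>W\<close> under the
  continuous maps \<open>\<phi> k\<close>, each defined on the open set \<open>A k\<close>.\<close>

lemma env_rel_saturation_open:
  fixes G (structure)
  assumes TG: "topological_group G TG" and top: "topological_partial_action G TX m"
    and W: "openin (prod_topology TG TX) W"
  shows "openin (prod_topology TG TX) (env_rel G (topspace TX) m `` W)"
proof -
  interpret topological_group G TG by (rule TG)
  interpret partial_action G "topspace TX" m
    using top by (simp add: topological_partial_action_def)
  let ?R = "env_rel G (topspace TX) m" and ?P = "prod_topology TG TX"
  define A where "A k = carrier G \<times> pa_set G m k" for k
  define \<phi> where "\<phi> k = (\<lambda>(h, y). (h \<otimes> k, pa_map m (inv k) y))" for k
  have A: "openin ?P (A k)" if "k \<in> carrier G" for k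
    using top that topspace_eq openin_topspace[of TG]
    by (simp add: A_def openin_prod_Times_iff topological_partial_action_def)
  have \<phi>: "continuous_map (subtopology ?P (A k)) ?P (\<phi> k)" if k: "k \<in> carrier G" for k
  proof -
    let ?S = "subtopology ?P (A k)"
    have "continuous_map ?S TG (\<lambda>p. fst p)"
      by (intro continuous_map_from_subtopology continuous_map_fst)
    then have "continuous_map ?S (prod_topology TG TG) (\<lambda>p. (fst p, k))"
      using k topspace_eq by (intro continuous_map_pairedI) auto
    from continuous_map_compose[OF this continuous_mult]
    have 1: "continuous_map ?S TG (\<lambda>p. fst p \<otimes> k)" by (simp add: o_def)
    have "homeomorphic_map (subtopology TX (pa_set G m (inv (inv k))))
        (subtopology TX (pa_set G m (inv k))) (pa_map m (inv k))"
      using top k unfolding topological_partial_action_def by blast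
    then have 2: "continuous_map (subtopology TX (pa_set G m k)) TX (pa_map m (inv k))"
      using k homeomorphic_imp_continuous_map continuous_map_in_subtopology by fastforce
    have "continuous_map ?S (subtopology TX (pa_set G m k)) (\<lambda>p. snd p)"
      by (auto simp: continuous_map_in_subtopology A_def
          intro: continuous_map_from_subtopology continuous_map_snd)
    from continuous_map_compose[OF this 2]
    have "continuous_map ?S TX (\<lambda>p. pa_map m (inv k) (snd p))" by (simp add: o_def)
    with 1 show ?thesis unfolding \<phi>_def case_prod_unfold by (rule continuous_map_pairedI)
  qed
  have "?R `` W = (\<Union>k\<in>carrier G. {p \<in> topspace (subtopology ?P (A k)). \<phi> k p \<in> W})"
  proof (intro equalityI subsetI)
    fix q assume "q \<in> ?R `` W"
    then obtain g x h y where q: "q = (h, y)" and w: "(g, x) \<in> W" and r: "((g, x), (h, y)) \<in> ?R"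
      by (metis ImageE prod.collapse)
    have gh: "g \<in> carrier G" "h \<in> carrier G" and m: "m (inv h \<otimes> g) x = Some y"
      using r by (auto simp: env_rel_iff)
    \<comment> \<open>The index to use is \<open>k = inv h \<otimes> g\<close>, the element that
      moves \<open>x\<close> to \<open>y\<close>.\<close>
    have m': "m (inv (inv h \<otimes> g)) y = Some x" using m by (rule PA1)
    moreover have "h \<otimes> (inv h \<otimes> g) = g" using gh by (simp add: inv_cancel)
    ultimately have "\<phi> (inv h \<otimes> g) q = (g, x)" by (simp add: \<phi>_def q pa_map_def)
    moreover have "q \<in> A (inv h \<otimes> g)" using gh m' by (simp add: A_def q pa_set_def)
    moreover have "inv h \<otimes> g \<in> carrier G" using gh by simp
    ultimately show "q \<in> (\<Union>k\<in>carrier G. {p \<in> topspace (subtopology ?P (A k)). \<phi> k p \<in> W})"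
      using w A openin_subset by fastforce
  next
    fix q assume "q \<in> (\<Union>k\<in>carrier G. {p \<in> topspace (subtopology ?P (A k)). \<phi> k p \<in> W})"
    then obtain k where k: "k \<in> carrier G" "q \<in> A k" "\<phi> k q \<in> W" by auto
    obtain h y where q: "q = (h, y)" by (cases q)
    obtain x where x: "m (inv k) y = Some x" and h: "h \<in> carrier G"
      using k(2) by (auto simp: A_def q pa_set_def)
    have "m k x = Some y" using PA1[OF x] k by simp
    then have "((h \<otimes> k, x), (h, y)) \<in> ?R" using h k by (simp add: env_rel_iff inv_cancel)
    moreover have "(h \<otimes> k, x) \<in> W" using k(3) x by (simp add: \<phi>_def q pa_map_def)
    ultimately show "q \<in> ?R `` W" using q by blast
  qed
  moreover have "openin ?P {p \<in> topspace (subtopology ?P (A k)). \<phi> k p \<in> W}" if "k \<in> carrier G" for k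
    using \<phi>[OF that] W A[OF that] openin_trans_full unfolding continuous_map_def by blast
  ultimately show ?thesis by auto
qed

text \<open>The class of \<open>(h, x)\<close> consists of the \<open>(g, y)\<close> for which
  \<open>g^{-1} h\<close> is defined at \<open>x\<close> and takes it to \<open>y\<close>. Being
  defined is a G-delta condition, as the preimage of \<open>G * X\<close> under the continuous map
  \<open>\<psi>\<close>. On that set the equation with \<open>y\<close> is a closed condition, hence
  G-delta in a metrizable space.\<close>

lemma env_class_gdelta:
  fixes G :: "('g, 'b) monoid_scheme" (structure) and TX :: "'x topology"
  assumes TG: "topological_group G TG" "metrizable_space TG" and TX: "metrizable_space TX"
    and top: "partial_action G (topspace TX) m"
    and cont: "continuous_partial_action TG TX m"
    and gd: "gdelta_in (prod_topology TG TX) (pa_dom m)"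
    and C: "C \<in> env_space G (topspace TX) m"
  shows "gdelta_in (prod_topology TG TX) C"
proof -
  interpret topological_group G TG by (rule TG)
  interpret partial_action G "topspace TX" m by (rule top)
  let ?P = "prod_topology TG TX"
  obtain h x where h: "h \<in> carrier G" "x \<in> topspace TX" and C: "C = env_rel G (topspace TX) m `` {(h, x)}"
    using C by (auto simp: env_space_def quotient_def)
  define \<psi> where "\<psi> = (\<lambda>p :: 'g \<times> 'x. (inv (fst p) \<otimes> h, x))"
  have "continuous_map ?P TG (\<lambda>p. inv (fst p))"
    using continuous_map_compose[OF continuous_map_fst continuous_inv] by (simp add: o_def)
  then have "continuous_map ?P (prod_topology TG TG) (\<lambda>p. (inv (fst p), h))"
    using h topspace_eq by (intro continuous_map_pairedI) auto
  from continuous_map_compose[OF this continuous_mult]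
  have "continuous_map ?P TG (\<lambda>p. inv (fst p) \<otimes> h)" by (simp add: o_def)
  then have \<psi>: "continuous_map ?P ?P \<psi>"
    using h unfolding \<psi>_def by (intro continuous_map_pairedI) auto
  define A where "A = {p \<in> topspace ?P. \<psi> p \<in> pa_dom m}"
  let ?S = "subtopology ?P A"
  have A: "gdelta_in ?P A" unfolding A_def by (rule gdelta_in_continuous_map_preimage[OF \<psi> gd])
  have "continuous_map ?S (subtopology ?P (pa_dom m)) \<psi>"
    using \<psi> by (auto simp: continuous_map_in_subtopology A_def intro: continuous_map_from_subtopology)
  from continuous_map_compose[OF this cont[unfolded continuous_partial_action_def]]
  have "continuous_map ?S TX (\<lambda>p. pa_map m (inv (fst p) \<otimes> h) x)" by (simp add: o_def \<psi>_def)
  moreover have "continuous_map ?S TX snd"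
    by (intro continuous_map_from_subtopology continuous_map_snd)
  ultimately have "closedin ?S {p \<in> topspace ?S. pa_map m (inv (fst p) \<otimes> h) x = snd p}"
    using TX metrizable_imp_Hausdorff_space by (intro closedin_continuous_maps_eq)
  moreover have "metrizable_space ?S"
    using TG(2) TX by (simp add: metrizable_space_prod_topology metrizable_space_subtopology)
  ultimately have "gdelta_in ?S {p \<in> topspace ?S. pa_map m (inv (fst p) \<otimes> h) x = snd p}"
    by (rule closed_imp_gdelta_in[rotated])
  moreover have "{p \<in> topspace ?S. pa_map m (inv (fst p) \<otimes> h) x = snd p} = C"
    using typing h topspace_eq
    by (auto simp: C A_def \<psi>_def env_rel_iff pa_dom_def pa_map_def)
  ultimately show ?thesis using gdelta_in_gdelta_subtopology[OF A] by simp
qed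

section \<open>Orbits of the enveloping action\<close>

context partial_action
begin

lemma env_act_eq_iff:
  assumes "k \<in> carrier G" "g \<in> carrier G" "x \<in> X" "h \<in> carrier G" "y \<in> X"
  shows "env_act G X m k (env_class G X m g x) = env_class G X m h y
    \<longleftrightarrow> m (inv h \<otimes> (k \<otimes> g)) x = Some y"
proof -
  have "env_act G X m k (env_class G X m g x) = env_class G X m h y
    \<longleftrightarrow> ((k \<otimes> g, x), (h, y)) \<in> env_rel G X m"
    unfolding env_act_class[OF assms(1-3)] unfolding env_class_def
    using assms by (intro eq_equiv_class_iff[OF equiv_env_rel]) auto
  then show ?thesis using assms by (simp add: env_rel_iff)
qed

lemma env_class_mem: "g \<in> carrier G \<Longrightarrow> x \<in> X \<Longrightarrow> env_class G X m g x \<in> env_space G X m"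
  by (auto simp: env_class_def env_space_def quotient_def)

text \<open>The enveloping action moves the first coordinate freely, so only the second coordinates
  of representatives matter. This makes both \<open>\<iota>\<close> and the projection of a chosen
  representative to \<open>X\<close> reductions.\<close>

lemma orbit_rel_env_class_iff:
  assumes "g \<in> carrier G" "x \<in> X" "h \<in> carrier G" "y \<in> X"
  shows "(env_class G X m g x, env_class G X m h y) \<in> orbit_rel G (env_space G X m) (env_act G X m)
    \<longleftrightarrow> (x, y) \<in> pa_orbit_rel m"
proof
  assume "(env_class G X m g x, env_class G X m h y) \<in> orbit_rel G (env_space G X m) (env_act G X m)"
  then show "(x, y) \<in> pa_orbit_rel m"
    using assms by (auto simp: orbit_rel_def pa_orbit_rel_def env_act_eq_iff)
next
  assume "(x, y) \<in> pa_orbit_rel m"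
  then obtain k where k: "m k x = Some y" by (auto simp: pa_orbit_rel_def)
  then have kG: "k \<in> carrier G" using typing by blast
  \<comment> \<open>Chosen so that \<open>h^{-1} ?k g = k\<close>.\<close>
  let ?k = "h \<otimes> k \<otimes> inv g"
  have "inv h \<otimes> (?k \<otimes> g) = k" using assms kG by (simp add: m_assoc inv_cancel)
  then have "env_act G X m ?k (env_class G X m g x) = env_class G X m h y"
    using assms kG k by (simp add: env_act_eq_iff)
  then show "(env_class G X m g x, env_class G X m h y) \<in> orbit_rel G (env_space G X m) (env_act G X m)"
    using assms kG env_class_mem by (auto simp: orbit_rel_def)
qed

lemma env_class_eq:
  assumes "C \<in> env_space G X m" "(g, x) \<in> C"
  shows "g \<in> carrier G" "x \<in> X" "C = env_class G X m g x"
proof -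
  have C: "C \<in> (carrier G \<times> X) // env_rel G X m" using assms(1) by (simp add: env_space_def)
  then show "g \<in> carrier G" "x \<in> X" using in_quotient_imp_subset[OF equiv_env_rel] assms(2) by auto
  show "C = env_class G X m g x"
    using C assms(2) unfolding env_class_def
    by (metis Image_singleton_iff equiv_class_eq equiv_env_rel quotientE)
qed

end

section \<open>Borel reductions in both directions\<close>

theorem theorem4p5:
  fixes G :: "('g, 'b) monoid_scheme"
    and TG :: "'g topology"
    and TX :: "'x topology"
    and m :: "'g \<Rightarrow> 'x \<Rightarrow> 'x option"
    and \<tau> :: "('g \<times> 'x) set topology"
  defines "R \<equiv> env_rel G (topspace TX) m"
    and "XG \<equiv> env_space G (topspace TX) m"
    and "\<iota> \<equiv> env_emb G (topspace TX) m"
    and "\<mu> \<equiv> env_act G (topspace TX) m"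
  assumes "polish_group G TG"
    and "polish_topology TX"
    and "topological_partial_action G TX m"
    and "continuous_partial_action TG TX m"
    and "gdelta_in (prod_topology TG TX) (pa_dom m)"
    and "topspace \<tau> = XG"
    and "polish_topology \<tau>"
    and "\<And>U. openin (quotient_topology (prod_topology TG TX) R) U \<Longrightarrow> openin \<tau> U"
    and "sets (borel_of \<tau>) = quotient_borel (prod_topology TG TX) R"
    and "sets (borel_of TX) = sets (borel_of (pullback_topology (topspace TX) \<iota> \<tau>))"
    and "(\<lambda>(g, a). \<mu> g a) \<in> borel_of (prod_topology TG \<tau>) \<rightarrow>\<^sub>M borel_of \<tau>"
  shows "borel_bireducible TX (pa_orbit_rel m) \<tau> (orbit_rel G XG \<mu>)"
proof -
  note ass = assms(5-15)
  let ?P = "prod_topology TG TX"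
  have TG: "topological_group G TG" "polish_topology TG"
    using ass(1) by (auto simp: polish_group_def)
  have pa: "partial_action G (topspace TX) m"
    using ass(3) by (simp add: topological_partial_action_def)
  interpret topological_group G TG by (rule TG)
  interpret partial_action G "topspace TX" m by (rule pa)
  have topP: "topspace ?P = carrier G \<times> topspace TX" by (simp add: topspace_eq)
  have XG: "XG = topspace ?P // R" by (simp add: XG_def R_def env_space_def topspace_eq)
  have equiv: "equiv (topspace ?P) R" unfolding R_def topP by (rule equiv_env_rel)
  have sat: "openin ?P (R `` W)" if "openin ?P W" for W
    unfolding R_def using TG(1) ass(3) that by (rule env_rel_saturation_open)
  have metr: "completely_metrizable_space TG" "completely_metrizable_space TX"
    using TG(2) ass(2) by (auto simp: polish_topology_def)

  have "borel_reducible TX (pa_orbit_rel m) \<tau> (orbit_rel G XG \<mu>)"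
    unfolding borel_reducible_def
  proof (rule bexI)
    have \<iota>X: "\<iota> x \<in> XG" if "x \<in> topspace TX" for x
      using that env_class_mem by (simp add: \<iota>_def env_emb_def XG_def)
    \<comment> \<open>In the topology pulled back along \<open>\<iota>\<close> the map
      \<open>\<iota>\<close> is continuous by construction, and this topology has the same Borel
      sets as \<open>TX\<close>.\<close>
    let ?T = "pullback_topology (topspace TX) \<iota> \<tau>"
    have top: "topspace ?T = topspace TX"
      using \<iota>X ass(6) by (auto simp: topspace_pullback_topology)
    have "continuous_map ?T \<tau> \<iota>"
      unfolding continuous_map_def using \<iota>X ass(6) top
      by (auto simp: openin_pullback_topology)
    then have "\<iota> \<in> borel_of ?T \<rightarrow>\<^sub>M borel_of \<tau>" by (rule measurable_borel_of_continuous_map)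
    then show "\<iota> \<in> borel_of TX \<rightarrow>\<^sub>M borel_of \<tau>"
      using measurable_cong_sets[OF ass(10) refl] by blast
    show "reduction (topspace TX) (pa_orbit_rel m) (orbit_rel G XG \<mu>) \<iota>"
      by (simp add: reduction_def \<iota>_def env_emb_def XG_def \<mu>_def orbit_rel_env_class_iff)
  qed
  moreover have "borel_reducible \<tau> (orbit_rel G XG \<mu>) TX (pa_orbit_rel m)"
  proof -
    obtain s where s: "s \<in> borel_of \<tau> \<rightarrow>\<^sub>M borel_of ?P" "\<And>C. C \<in> topspace ?P // R \<Longrightarrow> s C \<in> C"
    proof (rule borel_selector[of ?P R "borel_of \<tau>"])
      show "completely_metrizable_space ?P"
        using metr by (simp add: completely_metrizable_space_prod_topology)
      show "second_countable ?P"
        using TG(2) ass(2) by (intro second_countable_prod_topology polish_imp_second_countable)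
      show "equiv (topspace ?P) R" by (rule equiv)
      show "openin ?P (R `` W)" if "openin ?P W" for W using that by (rule sat)
      show "gdelta_in ?P C" if "C \<in> topspace ?P // R" for C
        using TG(1) _ _ pa ass(4,5) that[folded XG, unfolded XG_def]
        by (rule env_class_gdelta) (use metr in \<open>auto intro: completely_metrizable_imp_metrizable_space\<close>)
      show "space (borel_of \<tau>) = topspace ?P // R" using ass(6) XG by simp
      fix W assume W: "openin ?P W"
      \<comment> \<open>The preimage of \<open>?H\<close> under the quotient map is the saturation
        of \<open>W\<close>, so \<open>?H\<close> is open in the quotient topology and therefore in
        the finer topology \<open>\<tau>\<close>.\<close>
      let ?H = "{C \<in> topspace ?P // R. C \<inter> W \<noteq> {}}"
      have "{p \<in> topspace ?P. R `` {p} \<in> ?H} = R `` W"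
      proof (intro equalityI subsetI)
        fix p assume "p \<in> {p \<in> topspace ?P. R `` {p} \<in> ?H}"
        then show "p \<in> R `` W" using equiv unfolding equiv_def by (blast dest: symD)
      next
        fix p assume "p \<in> R `` W"
        then obtain w where w: "w \<in> W" "(w, p) \<in> R" by blast
        then have "(p, w) \<in> R" using equiv unfolding equiv_def by (blast dest: symD)
        moreover from this have "p \<in> topspace ?P" using equiv equiv_type by blast
        ultimately show "p \<in> {p \<in> topspace ?P. R `` {p} \<in> ?H}" using w by (auto intro: quotientI)
      qed
      then have "openin (quotient_topology ?P R) ?H"
        using sat[OF W] by (simp add: openin_quotient_topology)
      then show "?H \<in> sets (borel_of \<tau>)" using ass(8) by (auto simp: sets_borel_of)
    qed blast
    show ?thesis
      unfolding borel_reducible_def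
    proof (rule bexI)
      \<comment> \<open>The selector followed by the projection to \<open>X\<close> forgets the
        group coordinate, which has no influence on the orbit of the class.\<close>
      show "snd \<circ> s \<in> borel_of \<tau> \<rightarrow>\<^sub>M borel_of TX"
        using s(1) measurable_borel_of_continuous_map[OF continuous_map_snd] by (rule measurable_comp)
      have "(C, D) \<in> orbit_rel G XG \<mu> \<longleftrightarrow> ((snd \<circ> s) C, (snd \<circ> s) D) \<in> pa_orbit_rel m"
        if "C \<in> XG" "D \<in> XG" for C D
      proof -
        have C: "C \<in> env_space G (topspace TX) m" "(fst (s C), snd (s C)) \<in> C"
          and D: "D \<in> env_space G (topspace TX) m" "(fst (s D), snd (s D)) \<in> D"
          using that s(2) XG XG_def by auto
        note c = env_class_eq[OF C] and d = env_class_eq[OF D]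
        show ?thesis
          using orbit_rel_env_class_iff[OF c(1,2) d(1,2)] c(3) d(3) by (simp add: XG_def \<mu>_def)
      qed
      then show "reduction (topspace \<tau>) (orbit_rel G XG \<mu>) (pa_orbit_rel m) (snd \<circ> s)"
        by (simp add: reduction_def ass(6))
    qed
  qed
  ultimately show ?thesis by (simp add: borel_bireducible_def)
qed

end
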